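(* Consider the Maxwell-Bloch equations with the rotating wave approximation on $\mathbb{R}^5$, $$\dot x_1=y_1,\quad \dot y_1=x_1z,\quad \dot x_2=y_2,\quad \dot y_2=x_2z,\quad \dot z=-(x_1y_1+x_2y_2).$$ Let $\tilde J:\mathbb{R}^6\to\mathbb{R}$, $\tilde J(q_1,q_2,q_3,p_1,p_2,p_3)=q_1p_2-q_2p_1$, and let $\varphi:\mathbb{R}^6\to\mathbb{R}^5$ be given by $\varphi(q_1,q_2,q_3,p_1,p_2,p_3)=(x_1,y_1,x_2,y_2,z)$ with $$x_1=q_1,\quad y_1=p_1,\quad x_2=q_2,\quad y_2=p_2,\quad z=p_3-\tfrac12(q_1^2+q_2^2).$$ Solving $\tilde J=J\circ\varphi$ for a function $J$ on $\mathbb{R}^5$ gives $J=x_1y_2-x_2y_1$, and $J$ is a constant of motion of the system $\dot x_1=y_1$, $\dot y_1=x_1z$, $\dot x_2=y_2$, $\dot y_2=x_2z$, $\dot z=-(x_1y_1+x_2y_2)$ (a third one, besides $H=\frac12(y_1^2+y_2^2+z^2)$ and $C=\frac12(x_1^2+x_2^2)+z$).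
   Context: A constant of motion of a system of differential equations is a smooth function that is constant along every solution. *)

theory Defs
  imports "HOL-Analysis.Analysis"
begin

lemma vector_5 [simp]:
  "(vector [a,b,c,d,e] :: ('a::zero)^5) $ 1 = a"
  "(vector [a,b,c,d,e] :: ('a::zero)^5) $ 2 = b"
  "(vector [a,b,c,d,e] :: ('a::zero)^5) $ 3 = c"
  "(vector [a,b,c,d,e] :: ('a::zero)^5) $ 4 = d"
  "(vector [a,b,c,d,e] :: ('a::zero)^5) $ 5 = e"
  unfolding vector_def by simp_all

lemma vector_6 [simp]:
  "(vector [a,b,c,d,e,f] :: ('a::zero)^6) $ 1 = a"
  "(vector [a,b,c,d,e,f] :: ('a::zero)^6) $ 2 = b"
  "(vector [a,b,c,d,e,f] :: ('a::zero)^6) $ 3 = c"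
  "(vector [a,b,c,d,e,f] :: ('a::zero)^6) $ 4 = d"
  "(vector [a,b,c,d,e,f] :: ('a::zero)^6) $ 5 = e"
  "(vector [a,b,c,d,e,f] :: ('a::zero)^6) $ 6 = f"
  unfolding vector_def by simp_all

text \<open>\<open>C\<^sup>k\<close> on the whole space. As the domain is finite-dimensional, \<open>x \<mapsto> Df(x)\<close> is
  \<open>C\<^sup>k\<close> iff \<open>x \<mapsto> Df(x) v\<close> is for each fixed \<open>v\<close>.\<close>

primrec Ck :: "nat \<Rightarrow> ('a::euclidean_space \<Rightarrow> 'b::real_normed_vector) \<Rightarrow> bool" where
  "Ck 0 f \<longleftrightarrow> continuous_on UNIV f"
| "Ck (Suc k) f \<longleftrightarrow>
     (\<forall>x. f differentiable (at x)) \<and> (\<forall>v. Ck k (\<lambda>x. frechet_derivative f (at x) v))"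

definition smooth :: "('a::euclidean_space \<Rightarrow> 'b::real_normed_vector) \<Rightarrow> bool" where
  "smooth f \<longleftrightarrow> (\<forall>k. Ck k f)"

text \<open>Solutions live on arbitrary real intervals (bounded or not, with or without endpoints);
  at an endpoint belonging to the interval the derivative is one-sided.\<close>

definition is_solution ::
  "('a::euclidean_space \<Rightarrow> 'a) \<Rightarrow> real set \<Rightarrow> (real \<Rightarrow> 'a) \<Rightarrow> bool" where
  "is_solution X I \<gamma> \<longleftrightarrow> is_interval I \<and>
     (\<forall>t\<in>I. (\<gamma> has_vector_derivative X (\<gamma> t)) (at t within I))"

definition constant_of_motion ::
  "('a::euclidean_space \<Rightarrow> 'a) \<Rightarrow> ('a \<Rightarrow> real) \<Rightarrow> bool" where
  "constant_of_motion X F \<longleftrightarrow> smooth F \<and>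
     (\<forall>I \<gamma>. is_solution X I \<gamma> \<longrightarrow> (F \<circ> \<gamma>) constant_on I)"

text \<open>Coordinates: on \<open>real^5\<close> the components 1, ..., 5 are
  \<open>x\<^sub>1, y\<^sub>1, x\<^sub>2, y\<^sub>2, z\<close> in this order; on \<open>real^6\<close> the components
  1, ..., 6 are \<open>q\<^sub>1, q\<^sub>2, q\<^sub>3, p\<^sub>1, p\<^sub>2, p\<^sub>3\<close>.\<close>

definition MB_field :: "real^5 \<Rightarrow> real^5" where
  "MB_field w = (let x1 = w$1; y1 = w$2; x2 = w$3; y2 = w$4; z = w$5 in
     vector [y1, x1 * z, y2, x2 * z, - (x1 * y1 + x2 * y2)])"

definition MB_H :: "real^5 \<Rightarrow> real" where
  "MB_H w = (let y1 = w$2; y2 = w$4; z = w$5 in 1/2 * (y1^2 + y2^2 + z^2))"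

definition MB_C :: "real^5 \<Rightarrow> real" where
  "MB_C w = (let x1 = w$1; x2 = w$3; z = w$5 in 1/2 * (x1^2 + x2^2) + z)"

definition MB_J :: "real^5 \<Rightarrow> real" where
  "MB_J w = (let x1 = w$1; y1 = w$2; x2 = w$3; y2 = w$4 in x1 * y2 - x2 * y1)"

definition MB_J_tilde :: "real^6 \<Rightarrow> real" where
  "MB_J_tilde u = (let q1 = u$1; q2 = u$2; p1 = u$4; p2 = u$5 in q1 * p2 - q2 * p1)"

definition MB_phi :: "real^6 \<Rightarrow> real^5" where
  "MB_phi u = (let q1 = u$1; q2 = u$2; q3 = u$3; p1 = u$4; p2 = u$5; p3 = u$6 in
     vector [q1, p1, q2, p2, p3 - 1/2 * (q1^2 + q2^2)])"

end

theory Submission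
  imports Defs
begin

text \<open>
  A function \<open>F\<close> is constant along every solution of \<open>x' = X(x)\<close> as soon as its derivative in
  direction \<open>X(x)\<close> vanishes at each point \<open>x\<close>: by the chain rule \<open>F \<circ> \<gamma>\<close> then has
  derivative zero on an interval (\<open>constant_of_motionI\<close>). For the Maxwell-Bloch field these
  directional derivatives are polynomials that cancel identically; for instance, along the field
  \<open>J = x\<^sub>1 y\<^sub>2 - x\<^sub>2 y\<^sub>1\<close> changes at the rate
  \<open>y\<^sub>1 y\<^sub>2 + x\<^sub>1 x\<^sub>2 z - y\<^sub>2 y\<^sub>1 - x\<^sub>2 x\<^sub>1 z = 0\<close>. Smoothness of the three functions
  is smoothness of polynomials in the coordinates, which follows from closure of the class
  \<open>C\<^sup>k\<close> under sums and products.

  That \<open>J\<close> is the only function with \<open>J \<circ> \<phi> = q\<^sub>1 p\<^sub>2 - q\<^sub>2 p\<^sub>1\<close> is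
  surjectivity of \<open>\<phi>\<close>: given \<open>z\<close>, the momentum \<open>p\<^sub>3\<close> can be solved for.

  Finally, the reflection \<open>(x\<^sub>1, y\<^sub>1) \<mapsto> (-x\<^sub>1, -y\<^sub>1)\<close> leaves \<open>H\<close> and \<open>C\<close> invariant
  and reverses the sign of \<open>J\<close>, so \<open>J\<close>, not being identically zero, cannot be a function
  of \<open>H\<close> and \<open>C\<close>.
\<close>

section \<open>Vectors with five components\<close>

text \<open>In the type \<open>5\<close> the numeral \<open>5\<close> denotes the residue \<open>0\<close>, which therefore plays the
  role of the last index.\<close>

lemma exhaust_5:
  fixes i :: 5
  shows "i = 1 \<or> i = 2 \<or> i = 3 \<or> i = 4 \<or> i = 5"
proof (induct i)
  case (of_int k)
  then have "k = 0 \<or> k = 1 \<or> k = 2 \<or> k = 3 \<or> k = 4"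
    by fastforce
  then show ?case
    by auto
qed

lemma vec_5_eqI:
  fixes v w :: "'a^5"
  assumes "v $ 1 = w $ 1" "v $ 2 = w $ 2" "v $ 3 = w $ 3" "v $ 4 = w $ 4" "v $ 5 = w $ 5"
  shows "v = w"
  unfolding vec_eq_iff using assms exhaust_5 by metis


section \<open>Smooth functions\<close>

text \<open>The definition of \<open>Ck\<close> says nothing directly about lower orders; the induction starts
  from the fact that differentiable functions are continuous.\<close>

lemma Ck_SucD: "Ck (Suc k) f \<Longrightarrow> Ck k f"
proof (induction k arbitrary: f)
  case 0
  then show ?case
    by (auto simp: continuous_on_eq_continuous_at differentiable_imp_continuous_within)
next
  case (Suc k)
  from Suc.prems have "\<And>x. f differentiable at x"
    and "\<And>v. Ck (Suc k) (\<lambda>x. frechet_derivative f (at x) v)"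
    by (simp_all only: Ck.simps(2)[of "Suc k"])
  with Suc.IH show ?case
    by simp
qed

lemma Ck_SucI:
  assumes "\<And>x. (f has_derivative D x) (at x)" and "\<And>v. Ck k (\<lambda>x. D x v)"
  shows "Ck (Suc k) f"
proof -
  have "frechet_derivative f (at x) = D x" for x
    using frechet_derivative_at[OF assms(1)[of x]] by simp
  then show ?thesis
    using assms by (auto simp: differentiable_def)
qed

lemma Ck_SucE:
  assumes "Ck (Suc k) f"
  obtains D where "\<And>x. (f has_derivative D x) (at x)" and "\<And>v. Ck k (\<lambda>x. D x v)"
  using assms that[of "\<lambda>x. frechet_derivative f (at x)"]
  by (simp add: frechet_derivative_works)

lemma Ck_const: "Ck k (\<lambda>x. c)"
proof (induction k arbitrary: c)
  case (Suc k)
  show ?case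
    by (rule Ck_SucI[OF has_derivative_const Suc.IH])
qed simp

lemma Ck_add:
  assumes "Ck k f" "Ck k g"
  shows "Ck k (\<lambda>x. f x + g x)"
  using assms
proof (induction k arbitrary: f g)
  case 0
  then show ?case
    by (simp add: continuous_on_add)
next
  case (Suc k)
  obtain Df where Df: "\<And>x. (f has_derivative Df x) (at x)" "\<And>v. Ck k (\<lambda>x. Df x v)"
    using Ck_SucE[OF Suc.prems(1)] by blast
  obtain Dg where Dg: "\<And>x. (g has_derivative Dg x) (at x)" "\<And>v. Ck k (\<lambda>x. Dg x v)"
    using Ck_SucE[OF Suc.prems(2)] by blast
  show ?case
    by (rule Ck_SucI[OF has_derivative_add[OF Df(1) Dg(1)]]) (rule Suc.IH[OF Df(2) Dg(2)])
qed

text \<open>The product rule expresses the derivative of \<open>f g\<close> through derivatives of one factor times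
  the other factor itself, so the induction uses the factors at the lower order as well.\<close>

lemma Ck_mult:
  fixes f g :: "'a::euclidean_space \<Rightarrow> 'b::real_normed_algebra"
  assumes "Ck k f" "Ck k g"
  shows "Ck k (\<lambda>x. f x * g x)"
  using assms
proof (induction k arbitrary: f g)
  case 0
  then show ?case
    by (simp add: continuous_on_mult)
next
  case (Suc k)
  obtain Df where Df: "\<And>x. (f has_derivative Df x) (at x)" "\<And>v. Ck k (\<lambda>x. Df x v)"
    using Ck_SucE[OF Suc.prems(1)] by blast
  obtain Dg where Dg: "\<And>x. (g has_derivative Dg x) (at x)" "\<And>v. Ck k (\<lambda>x. Dg x v)"
    using Ck_SucE[OF Suc.prems(2)] by blast
  have "Ck k f" "Ck k g"
    using Suc.prems by (simp_all only: Ck_SucD)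
  then show ?case
    by (intro Ck_SucI[OF has_derivative_mult[OF Df(1) Dg(1)]] Ck_add Suc.IH Df(2) Dg(2))
qed

lemma smooth_const: "smooth (\<lambda>x. c)"
  by (simp add: smooth_def Ck_const)

lemma smooth_bounded_linear:
  assumes "bounded_linear f"
  shows "smooth f"
  unfolding smooth_def
proof
  fix k
  show "Ck k f"
  proof (cases k)
    case 0
    then show ?thesis
      using assms by (simp add: linear_continuous_on)
  next
    case (Suc m)
    have "Ck (Suc m) f"
      by (rule Ck_SucI[OF bounded_linear_imp_has_derivative[OF assms] Ck_const])
    then show ?thesis
      using Suc by simp
  qed
qed

lemma smooth_add: "smooth f \<Longrightarrow> smooth g \<Longrightarrow> smooth (\<lambda>x. f x + g x)"
  by (simp add: smooth_def Ck_add)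

lemma smooth_mult:
  fixes f g :: "'a::euclidean_space \<Rightarrow> 'b::real_normed_algebra"
  shows "smooth f \<Longrightarrow> smooth g \<Longrightarrow> smooth (\<lambda>x. f x * g x)"
  by (simp add: smooth_def Ck_mult)

lemma smooth_diff:
  fixes f g :: "'a::euclidean_space \<Rightarrow> real"
  assumes "smooth f" "smooth g"
  shows "smooth (\<lambda>x. f x - g x)"
  using smooth_add[OF assms(1) smooth_mult[OF smooth_const[of "-1"] assms(2)]] by simp

lemma smooth_component: "smooth (\<lambda>w :: real^'n. w $ i)"
  by (rule smooth_bounded_linear) (rule bounded_linear_vec_nth)

lemmas smooth_intros = smooth_const smooth_component smooth_add smooth_diff smooth_mult


section \<open>Constants of motion\<close>

text \<open>The chain rule gives \<open>(F \<circ> \<gamma>)' = DF(\<gamma>) X(\<gamma>) = 0\<close>, one-sided at endpoints, and a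
  function whose derivative vanishes on a convex set is constant there.\<close>

lemma constant_of_motionI:
  assumes smooth: "smooth F"
    and deriv: "\<And>x. (F has_derivative D x) (at x)"
    and zero: "\<And>x. D x (X x) = 0"
  shows "constant_of_motion X F"
  unfolding constant_of_motion_def
proof (intro conjI allI impI smooth)
  fix I \<gamma>
  assume "is_solution X I \<gamma>"
  then have I: "convex I" and \<gamma>: "\<And>t. t \<in> I \<Longrightarrow> (\<gamma> has_vector_derivative X (\<gamma> t)) (at t within I)"
    by (auto simp: is_solution_def is_interval_convex)
  have "((F \<circ> \<gamma>) has_vector_derivative 0) (at t within I)" if "t \<in> I" for t
  proof -
    have "((F \<circ> \<gamma>) has_vector_derivative D (\<gamma> t) (X (\<gamma> t))) (at t within I)"
      by (rule vector_derivative_diff_chain_within[OF \<gamma>[OF that]])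
        (rule has_derivative_at_withinI[OF deriv])
    then show ?thesis
      by (simp add: zero)
  qed
  then obtain c where "\<And>t. t \<in> I \<Longrightarrow> (F \<circ> \<gamma>) t = c"
    using has_vector_derivative_zero_constant[OF I] by blast
  then show "(F \<circ> \<gamma>) constant_on I"
    unfolding constant_on_def by blast
qed


section \<open>The Maxwell-Bloch system\<close>

lemma constant_of_motion_MB_J: "constant_of_motion MB_field MB_J"
proof (rule constant_of_motionI)
  show "smooth MB_J"
    unfolding MB_J_def Let_def by (intro smooth_intros)
  show "(MB_J has_derivative
      (\<lambda>v. v$1 * w$4 + w$1 * v$4 - (v$3 * w$2 + w$3 * v$2))) (at w)" for w
    unfolding MB_J_def Let_def
    by (auto intro!: derivative_eq_intros bounded_linear_imp_has_derivative bounded_linear_vec_nth)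
qed (simp add: MB_field_def Let_def algebra_simps)

lemma constant_of_motion_MB_H: "constant_of_motion MB_field MB_H"
proof (rule constant_of_motionI)
  show "smooth MB_H"
    unfolding MB_H_def Let_def power2_eq_square by (intro smooth_intros)
  show "(MB_H has_derivative (\<lambda>v. w$2 * v$2 + w$4 * v$4 + w$5 * v$5)) (at w)" for w
    unfolding MB_H_def Let_def
    by (auto intro!: derivative_eq_intros bounded_linear_imp_has_derivative bounded_linear_vec_nth
        simp: algebra_simps)
qed (simp add: MB_field_def Let_def algebra_simps)

lemma constant_of_motion_MB_C: "constant_of_motion MB_field MB_C"
proof (rule constant_of_motionI)
  show "smooth MB_C"
    unfolding MB_C_def Let_def power2_eq_square by (intro smooth_intros)
  show "(MB_C has_derivative (\<lambda>v. w$1 * v$1 + w$3 * v$3 + v$5)) (at w)" for w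
    unfolding MB_C_def Let_def
    by (auto intro!: derivative_eq_intros bounded_linear_imp_has_derivative bounded_linear_vec_nth
        simp: algebra_simps)
qed (simp add: MB_field_def Let_def algebra_simps)

lemma MB_J_tilde_eq: "MB_J_tilde = MB_J \<circ> MB_phi"
  by (simp add: fun_eq_iff MB_J_tilde_def MB_J_def MB_phi_def Let_def)

lemma surj_MB_phi: "surj MB_phi"
proof (rule surjI)
  \<comment> \<open>A section of \<open>\<phi>\<close> with \<open>q\<^sub>3 = 0\<close>.\<close>
  show "MB_phi (vector [w$1, w$3, 0, w$2, w$4, w$5 + 1/2 * ((w$1)^2 + (w$3)^2)]) = w" for w
    by (rule vec_5_eqI) (simp_all add: MB_phi_def Let_def)
qed

lemma MB_J_tilde_factor_iff: "MB_J_tilde = J \<circ> MB_phi \<longleftrightarrow> J = MB_J"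
  unfolding MB_J_tilde_eq using surj_fun_eq[OF surj_MB_phi, of MB_J J] by (auto simp: fun_eq_iff)

text \<open>The two points compared are mirror images under \<open>(x\<^sub>1, y\<^sub>1) \<mapsto> (-x\<^sub>1, -y\<^sub>1)\<close>, where
  \<open>J\<close> takes the values \<open>1\<close> and \<open>-1\<close>.\<close>

lemma MB_J_not_function_of_MB_H_MB_C: "MB_J \<noteq> (\<lambda>w. F (MB_H w) (MB_C w))"
proof
  assume J: "MB_J = (\<lambda>w. F (MB_H w) (MB_C w))"
  define a b :: "real^5" where "a = vector [1, 0, 0, 1, 0]" and "b = vector [-1, 0, 0, 1, 0]"
  have "MB_H a = MB_H b" "MB_C a = MB_C b"
    by (simp_all add: a_def b_def MB_H_def MB_C_def Let_def)
  then have "MB_J a = MB_J b"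
    by (simp add: J)
  then show False
    by (simp add: a_def b_def MB_J_def Let_def)
qed

lemma MB_H_neq_MB_C: "MB_H \<noteq> MB_C"
proof
  assume "MB_H = MB_C"
  then have "MB_H (vector [0, 1, 0, 0, 0]) = MB_C (vector [0, 1, 0, 0, 0])"
    by simp
  then show False
    by (simp add: MB_H_def MB_C_def Let_def)
qed

theorem theorem3p4:
  shows "(\<forall>J :: real^5 \<Rightarrow> real. MB_J_tilde = J \<circ> MB_phi \<longleftrightarrow> J = MB_J) \<and>
    constant_of_motion MB_field MB_J \<and>
    constant_of_motion MB_field MB_H \<and>
    constant_of_motion MB_field MB_C \<and>
    distinct [MB_H, MB_C, MB_J] \<and>
    \<not> (\<exists>F :: real \<Rightarrow> real \<Rightarrow> real. MB_J = (\<lambda>w. F (MB_H w) (MB_C w)))"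
proof (intro conjI allI)
  \<comment> \<open>Functional independence with \<open>F\<close> a projection separates \<open>J\<close> from \<open>H\<close> and from \<open>C\<close>.\<close>
  have "MB_J \<noteq> MB_H" "MB_J \<noteq> MB_C"
    using MB_J_not_function_of_MB_H_MB_C[of "\<lambda>h c. h"] MB_J_not_function_of_MB_H_MB_C[of "\<lambda>h c. c"]
    by simp_all
  with MB_H_neq_MB_C show "distinct [MB_H, MB_C, MB_J]"
    by auto
qed (simp_all add: MB_J_tilde_factor_iff constant_of_motion_MB_J constant_of_motion_MB_H
    constant_of_motion_MB_C MB_J_not_function_of_MB_H_MB_C)

end
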